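(* Let $X$ be a real linear space, $(Y,N)$ a fuzzy Banach space and $(Z,N')$ a fuzzy normed space. Let $\varphi_1: X\times X\to Z$ be a function such that for some real $\alpha$ with $0<\alpha<4$, $$N'\left(\varphi_1\left(\tfrac{2x}{3},2y\right),a\right)\ \ge\ N'\left(\alpha\,\varphi_1\left(\tfrac{x}{3},y\right),a\right)$$ for all $x\in X$, all $y\in\{0,\tfrac{x}{3},\tfrac{4x}{3},\tfrac{-2x}{3},x\}$ and all $a>0$, and such that $$\lim_{n\to\infty}N'\left(\varphi_1(2^nx,2^ny),4^na\right)=1$$ for all $x,y\in X$ and all $a>0$. Let $f:X\to Y$ be an even function with $f(0)=0$ satisfying $$N\big(f(2x+y)+f(2x-y)-f(x+y)-f(x-y)-2f(2x)+2f(x),\,a\big)\ \ge\ N'(\varphi_1(x,y),a)$$ for all $a>0$ and all $x,y\in X$. Then there exists a unique quadratic mapping $Q:X\to Y$ such that $$N(Q(x)-f(x),a)\ \ge\ N''_1\left(x,\tfrac{a(4-\alpha)}{6}\right)$$ for all $x\in X$ and all $a>0$, where $$N''_1(x,a):=\min\Big\{N'\big(\varphi_1(\tfrac{x}{3},\tfrac{x}{3}),a\big),\,N'\big(\varphi_1(\tfrac{x}{3},x),a\big),\,N'\big(\varphi_1(\tfrac{x}{3},\tfrac{4x}{3}),a\big),\,N'\big(\varphi_1(\tfrac{x}{3},\tfrac{-2x}{3}),a\big),\,N'\big(\varphi_1(\tfrac{x}{3},0),a\big)\Big\}.$$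
   Context: Let $V$ be a real linear space. A function $N:V\times\mathbb{R}\to[0,1]$ is a fuzzy norm on $V$ if for all $x,y\in V$ and $a,b\in\mathbb{R}$: (N1) $N(x,a)=0$ for $a\le 0$; (N2) $x=0$ if and only if $N(x,a)=1$ for all $a>0$; (N3) $N(ax,b)=N(x,\frac{b}{|a|})$ if $a\ne 0$; (N4) $N(x+y,a+b)\ge\min\{N(x,a),N(y,b)\}$; (N5) $N(x,\cdot)$ is a non-decreasing function on $\mathbb{R}$ and $\lim_{a\to\infty}N(x,a)=1$; (N6) for $x\ne 0$, $N(x,\cdot)$ is upper semicontinuous on $\mathbb{R}$. The pair $(V,N)$ is then called a fuzzy normed (linear) space. A sequence $(x_n)$ in $V$ is convergent if there exists $x\in V$ with $\lim_{n\to\infty}N(x_n-x,a)=1$ for all $a>0$. It is Cauchy if for each $\epsilon>0$ and each $a>0$ there exists $n_0$ such that $N(x_{n+p}-x_n,a)>1-\epsilon$ for all $n\ge n_0$ and all $p>0$ (integers). A fuzzy Banach space is a fuzzy normed space in which every Cauchy sequence is convergent. A mapping $Q:X\to Y$ between real linear spaces is quadratic if $Q(x+y)+Q(x-y)=2Q(x)+2Q(y)$ for all $x,y\in X$. A function $f$ is even if $f(-x)=f(x)$ for all $x$. *)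

theory Defs
  imports "HOL-Analysis.Analysis"
begin

definition upper_semicontinuous :: "(real \<Rightarrow> real) \<Rightarrow> bool" where
  "upper_semicontinuous g \<longleftrightarrow> (\<forall>t. \<forall>c > g t. \<forall>\<^sub>F s in at t. g s < c)"

locale fuzzy_normed_space =
  fixes N :: "'v::real_vector \<Rightarrow> real \<Rightarrow> real"
  assumes range: "\<And>x a. N x a \<in> {0..1}"
    and N1: "\<And>x a. a \<le> 0 \<Longrightarrow> N x a = 0"
    and N2: "\<And>x. x = 0 \<longleftrightarrow> (\<forall>a>0. N x a = 1)"
    and N3: "\<And>x a b. a \<noteq> 0 \<Longrightarrow> N (a *\<^sub>R x) b = N x (b / \<bar>a\<bar>)"
    and N4: "\<And>x y a b. N (x + y) (a + b) \<ge> min (N x a) (N y b)"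
    and N5: "\<And>x. mono (N x)" "\<And>x. (N x \<longlongrightarrow> 1) at_top"
    and N6: "\<And>x. x \<noteq> 0 \<Longrightarrow> upper_semicontinuous (N x)"

definition fuzzy_convergent :: "('v::real_vector \<Rightarrow> real \<Rightarrow> real) \<Rightarrow> (nat \<Rightarrow> 'v) \<Rightarrow> bool" where
  "fuzzy_convergent N u \<longleftrightarrow> (\<exists>x. \<forall>a>0. (\<lambda>n. N (u n - x) a) \<longlonglongrightarrow> 1)"

definition fuzzy_Cauchy :: "('v::real_vector \<Rightarrow> real \<Rightarrow> real) \<Rightarrow> (nat \<Rightarrow> 'v) \<Rightarrow> bool" where
  "fuzzy_Cauchy N u \<longleftrightarrow>
     (\<forall>\<epsilon>>0. \<forall>a>0. \<exists>n\<^sub>0. \<forall>n\<ge>n\<^sub>0. \<forall>p>0. N (u (n + p) - u n) a > 1 - \<epsilon>)"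

locale fuzzy_Banach_space = fuzzy_normed_space +
  assumes complete: "\<And>u. fuzzy_Cauchy N u \<Longrightarrow> fuzzy_convergent N u"

definition quadratic :: "('a::real_vector \<Rightarrow> 'b::real_vector) \<Rightarrow> bool" where
  "quadratic Q \<longleftrightarrow> (\<forall>x y. Q (x + y) + Q (x - y) = 2 *\<^sub>R Q x + 2 *\<^sub>R Q y)"

definition N1'' :: "('z::real_vector \<Rightarrow> real \<Rightarrow> real) \<Rightarrow> ('a::real_vector \<Rightarrow> 'a \<Rightarrow> 'z) \<Rightarrow> 'a \<Rightarrow> real \<Rightarrow> real" where
  "N1'' N' \<phi> x a = Min {
     N' (\<phi> ((1/3) *\<^sub>R x) ((1/3) *\<^sub>R x)) a,
     N' (\<phi> ((1/3) *\<^sub>R x) x) a,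
     N' (\<phi> ((1/3) *\<^sub>R x) ((4/3) *\<^sub>R x)) a,
     N' (\<phi> ((1/3) *\<^sub>R x) ((-2/3) *\<^sub>R x)) a,
     N' (\<phi> ((1/3) *\<^sub>R x) 0) a}"

end

theory Submission
  imports Defs "HOL-Real_Asymp.Real_Asymp"
begin

text \<open>
  Writing \<open>D x y\<close> for the left-hand side of the functional inequality and \<open>t = x / 3\<close>, evenness and
  \<open>f 0 = 0\<close> give \<open>f (2x) - 4 f x = D t (4t) + D t (3t) + D t (-2t) - 2 D t t\<close>. Hence
  \<open>f (2x) - 4 f x\<close> is controlled at scale \<open>5a\<close> by \<open>N1''\<close> at scale \<open>a\<close>, and the geometric series of
  ratio \<open>\<alpha> / 4\<close> makes \<open>f (2\<^sup>n x) / 4\<^sup>n\<close> Cauchy, within \<open>5a / (4 - \<alpha>)\<close> of \<open>f x\<close>. The slack between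
  5 and 6 absorbs the passage to the limit \<open>Q\<close>. The limit satisfies \<open>D = 0\<close> and \<open>Q (2x) = 4 Q x\<close>, so
  its quadratic defect \<open>E x y = Q (x + y) + Q (x - y) - 2 Q x - 2 Q y\<close> is symmetric, unchanged by
  doubling one argument, and multiplied by 4 on doubling both; therefore \<open>E = 0\<close>.
\<close>

section \<open>Limits with respect to a fuzzy norm\<close>

definition fuzzy_tendsto :: "('v::real_vector \<Rightarrow> real \<Rightarrow> real) \<Rightarrow> (nat \<Rightarrow> 'v) \<Rightarrow> 'v \<Rightarrow> bool" where
  "fuzzy_tendsto N u x \<longleftrightarrow> (\<forall>a>0. (\<lambda>n. N (u n - x) a) \<longlonglongrightarrow> 1)"

context fuzzy_normed_space
begin

lemma le_one: "N x a \<le> 1"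
  using range[of x a] by simp

lemma N_zero: "a > 0 \<Longrightarrow> N 0 a = 1"
  using N2 by blast

lemma N_minus: "N (- x) a = N x a"
  using N3[of "-1" x a] by simp

lemma N_diff_commute: "N (x - y) a = N (y - x) a"
  using N_minus[of "x - y" a] by simp

lemma N_scaleR: "c > 0 \<Longrightarrow> N (c *\<^sub>R x) (c * a) = N x a"
  using N3[of c x "c * a"] by simp

text \<open>A common lower bound \<open>c\<close> passes through sums while the scales add, so later
  estimates reduce to bookkeeping of scales.\<close>

lemma le_N_add: "c \<le> N x a \<Longrightarrow> c \<le> N y b \<Longrightarrow> c \<le> N (x + y) (a + b)"
  using N4[of x a y b] by linarith

lemma tendsto_oneI:
  assumes "\<And>n. g n \<le> N (v n) a" and "g \<longlonglongrightarrow> 1"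
  shows "(\<lambda>n. N (v n) a) \<longlonglongrightarrow> 1"
  by (rule tendsto_sandwich[OF _ _ assms(2) tendsto_const]) (use assms(1) le_one in auto)

lemma fuzzy_tendsto_add:
  assumes "fuzzy_tendsto N u x" and "fuzzy_tendsto N v y"
  shows "fuzzy_tendsto N (\<lambda>n. u n + v n) (x + y)"
  unfolding fuzzy_tendsto_def
proof (intro allI impI)
  fix a :: real assume "a > 0"
  then have "(\<lambda>n. min (N (u n - x) (a/2)) (N (v n - y) (a/2))) \<longlonglongrightarrow> min 1 1"
    using assms unfolding fuzzy_tendsto_def by (intro tendsto_min) auto
  moreover have "min (N (u n - x) (a/2)) (N (v n - y) (a/2)) \<le> N (u n + v n - (x + y)) a" for n
    using N4[of "u n - x" "a/2" "v n - y" "a/2"] by (simp add: algebra_simps)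
  ultimately show "(\<lambda>n. N (u n + v n - (x + y)) a) \<longlonglongrightarrow> 1"
    by (intro tendsto_oneI) auto
qed

lemma fuzzy_tendsto_scaleR:
  assumes "fuzzy_tendsto N u x"
  shows "fuzzy_tendsto N (\<lambda>n. c *\<^sub>R u n) (c *\<^sub>R x)"
proof (cases "c = 0")
  case True
  then show ?thesis by (simp add: fuzzy_tendsto_def N_zero)
next
  case False
  then have "N (c *\<^sub>R u n - c *\<^sub>R x) a = N (u n - x) (a / \<bar>c\<bar>)" for n a
    using N3[of c "u n - x" a] by (simp add: scaleR_diff_right)
  then show ?thesis
    using assms False by (simp add: fuzzy_tendsto_def)
qed

lemma fuzzy_tendsto_diff:
  "fuzzy_tendsto N u x \<Longrightarrow> fuzzy_tendsto N v y \<Longrightarrow> fuzzy_tendsto N (\<lambda>n. u n - v n) (x - y)"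
  using fuzzy_tendsto_add[of u x "\<lambda>n. (-1) *\<^sub>R v n" "(-1) *\<^sub>R y"] fuzzy_tendsto_scaleR[of v y "-1"]
  by simp

lemma fuzzy_tendsto_Suc:
  assumes "fuzzy_tendsto N u x" shows "fuzzy_tendsto N (\<lambda>n. u (Suc n)) x"
  unfolding fuzzy_tendsto_def
proof (intro allI impI)
  fix a :: real assume "a > 0"
  then have "(\<lambda>n. N (u n - x) a) \<longlonglongrightarrow> 1"
    using assms by (simp add: fuzzy_tendsto_def)
  then show "(\<lambda>n. N (u (Suc n) - x) a) \<longlonglongrightarrow> 1"
    by (rule LIMSEQ_Suc)
qed

lemma fuzzy_tendsto_const_eq:
  assumes "fuzzy_tendsto N (\<lambda>n. x) y" shows "x = y"
proof -
  have "N (x - y) a = 1" if "a > 0" for a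
    using assms that by (auto simp: fuzzy_tendsto_def LIMSEQ_const_iff)
  then have "x - y = 0" using N2 by blast
  then show ?thesis by simp
qed

lemma fuzzy_tendsto_unique:
  assumes "fuzzy_tendsto N u x" and "fuzzy_tendsto N u y" shows "x = y"
  using fuzzy_tendsto_const_eq[of 0 "x - y"] fuzzy_tendsto_diff[OF assms] by simp

end

section \<open>Quadratic maps and doubling\<close>

lemma quadratic_scaleR_two_power:
  assumes "quadratic Q"
  shows "Q (2 ^ n *\<^sub>R x) = 4 ^ n *\<^sub>R Q x"
proof (induction n)
  case (Suc n)
  have "2 *\<^sub>R Q 0 = 4 *\<^sub>R Q 0"
    using assms[unfolded quadratic_def, rule_format, of 0 0]
    by (simp flip: scaleR_2 scaleR_add_left)
  then have "Q 0 = 0"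
    by simp
  moreover have "Q (2 ^ n *\<^sub>R x + 2 ^ n *\<^sub>R x) + Q 0 = 4 *\<^sub>R Q (2 ^ n *\<^sub>R x)"
    using assms[unfolded quadratic_def, rule_format, of "2 ^ n *\<^sub>R x" "2 ^ n *\<^sub>R x"]
    by (simp flip: scaleR_add_left)
  moreover have "2 ^ n *\<^sub>R x + 2 ^ n *\<^sub>R x = 2 ^ Suc n *\<^sub>R x"
    by (simp flip: scaleR_add_left)
  ultimately show ?case using Suc by simp
qed simp

text \<open>Hypothesis \<open>eq\<close> expresses the invariance of the defect under doubling its
  first argument; evenness carries this over to the second argument, and \<open>double\<close>
  supplies the factor 4 that forces the defect to vanish.\<close>

lemma quadraticI_doubling:
  fixes Q :: "'a::real_vector \<Rightarrow> 'b::real_vector"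
  assumes even: "\<And>x. Q (- x) = Q x" and double: "\<And>x. Q (2 *\<^sub>R x) = 4 *\<^sub>R Q x"
    and eq: "\<And>x y. Q (2 *\<^sub>R x + y) + Q (2 *\<^sub>R x - y) - Q (x + y) - Q (x - y)
                - 2 *\<^sub>R Q (2 *\<^sub>R x) + 2 *\<^sub>R Q x = 0"
  shows "quadratic Q"
proof -
  define E where "E x y = Q (x + y) + Q (x - y) - 2 *\<^sub>R Q x - 2 *\<^sub>R Q y" for x y
  have sym: "E x y = E y x" for x y
    using even[of "x - y"] by (simp add: E_def algebra_simps)
  have left: "E (2 *\<^sub>R x) y = E x y" for x y
  proof -
    have "E (2 *\<^sub>R x) y - E x y = Q (2 *\<^sub>R x + y) + Q (2 *\<^sub>R x - y) - Q (x + y) - Q (x - y)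
                - 2 *\<^sub>R Q (2 *\<^sub>R x) + 2 *\<^sub>R Q x"
      by (simp add: E_def algebra_simps)
    then show ?thesis using eq by simp
  qed
  have "4 *\<^sub>R E x y = E x y" for x y
  proof -
    have "E (2 *\<^sub>R x) (2 *\<^sub>R y) = 4 *\<^sub>R E x y"
      using double[of "x + y"] double[of "x - y"]
      by (simp add: E_def double scaleR_add_right scaleR_diff_right)
    moreover have "E (2 *\<^sub>R x) (2 *\<^sub>R y) = E x y"
      using left sym by metis
    ultimately show ?thesis by simp
  qed
  then have "3 *\<^sub>R E x y = 0" for x y
    using scaleR_diff_left[of 4 1 "E x y"] by simp
  then have "E x y = 0" for x y
    by simp
  then show ?thesis
    by (simp add: quadratic_def E_def algebra_simps)
qed

section \<open>The control function \<open>N1''\<close> and a single doubling\<close>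

lemma le_N1''_iff:
  "c \<le> N1'' N' \<phi> x a \<longleftrightarrow>
     c \<le> N' (\<phi> ((1/3) *\<^sub>R x) ((1/3) *\<^sub>R x)) a \<and> c \<le> N' (\<phi> ((1/3) *\<^sub>R x) x) a \<and>
     c \<le> N' (\<phi> ((1/3) *\<^sub>R x) ((4/3) *\<^sub>R x)) a \<and> c \<le> N' (\<phi> ((1/3) *\<^sub>R x) ((-2/3) *\<^sub>R x)) a \<and>
     c \<le> N' (\<phi> ((1/3) *\<^sub>R x) 0) a"
  unfolding N1''_def by (subst Min_ge_iff) auto

lemma tendsto_N1'':
  assumes "fuzzy_normed_space N'" and "filterlim s at_top F"
  shows "((\<lambda>n. N1'' N' \<phi> x (s n)) \<longlongrightarrow> 1) F"
proof -
  have *: "((\<lambda>n. N' z (s n)) \<longlongrightarrow> 1) F" for z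
    using filterlim_compose[OF fuzzy_normed_space.N5(2)[OF assms(1)] assms(2)] .
  have "((\<lambda>n. min (N' (\<phi> ((1/3) *\<^sub>R x) ((1/3) *\<^sub>R x)) (s n)) (min (N' (\<phi> ((1/3) *\<^sub>R x) x) (s n))
     (min (N' (\<phi> ((1/3) *\<^sub>R x) ((4/3) *\<^sub>R x)) (s n)) (min (N' (\<phi> ((1/3) *\<^sub>R x) ((-2/3) *\<^sub>R x)) (s n))
     (N' (\<phi> ((1/3) *\<^sub>R x) 0) (s n)))))) \<longlongrightarrow> min 1 (min 1 (min 1 (min 1 1)))) F"
    by (intro tendsto_min *)
  then show ?thesis by (simp add: N1''_def)
qed

text \<open>Each of the five terms at \<open>2 x\<close> has twice the pair of arguments of the
  matching term at \<open>x\<close>, and enlarging the scale by \<open>\<alpha>\<close> absorbs the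
  scalar \<open>\<alpha>\<close> of the hypothesis.\<close>

lemma N1''_double:
  assumes "fuzzy_normed_space N'" and "0 < \<alpha>" and "a > 0"
    and "\<And>y a. y \<in> {0, (1/3) *\<^sub>R x, (4/3) *\<^sub>R x, (-2/3) *\<^sub>R x, x} \<Longrightarrow> a > 0 \<Longrightarrow>
           N' (\<phi> ((2/3) *\<^sub>R x) (2 *\<^sub>R y)) a \<ge> N' (\<alpha> *\<^sub>R \<phi> ((1/3) *\<^sub>R x) y) a"
  shows "N1'' N' \<phi> x a \<le> N1'' N' \<phi> (2 *\<^sub>R x) (\<alpha> * a)"
proof -
  have *: "N1'' N' \<phi> x a \<le> N' (\<phi> ((2/3) *\<^sub>R x) (2 *\<^sub>R y)) (\<alpha> * a)"
    if y: "y \<in> {0, (1/3) *\<^sub>R x, (4/3) *\<^sub>R x, (-2/3) *\<^sub>R x, x}" for y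
  proof -
    have "N1'' N' \<phi> x a \<le> N' (\<phi> ((1/3) *\<^sub>R x) y) a"
      using le_N1''_iff[of "N1'' N' \<phi> x a" N' \<phi> x a] y by auto
    also have "\<dots> = N' (\<alpha> *\<^sub>R \<phi> ((1/3) *\<^sub>R x) y) (\<alpha> * a)"
      using fuzzy_normed_space.N_scaleR[OF assms(1,2)] by simp
    also have "\<dots> \<le> N' (\<phi> ((2/3) *\<^sub>R x) (2 *\<^sub>R y)) (\<alpha> * a)"
      using assms(4)[OF y] assms(2,3) by simp
    finally show ?thesis .
  qed
  show ?thesis
    using *[of 0] *[of "(1/3) *\<^sub>R x"] *[of "(4/3) *\<^sub>R x"] *[of "(-2/3) *\<^sub>R x"] *[of x]
    by (simp add: le_N1''_iff)
qed

text \<open>The constant 5 counts the summands of the identity with multiplicity: three values of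
  \<open>D\<close> enter once, one enters twice, and each copy costs scale \<open>a\<close>.\<close>

lemma (in fuzzy_normed_space) near_doubling:
  fixes f :: "'x::real_vector \<Rightarrow> 'v"
  assumes even: "\<And>x. f (- x) = f x" and f0: "f 0 = 0" and a: "a > 0"
    and D: "\<And>x y a. a > 0 \<Longrightarrow>
           N (f (2 *\<^sub>R x + y) + f (2 *\<^sub>R x - y) - f (x + y) - f (x - y)
                - 2 *\<^sub>R f (2 *\<^sub>R x) + 2 *\<^sub>R f x) a \<ge> N' (\<phi> x y) a"
  shows "N1'' N' \<phi> x a \<le> N (f (2 *\<^sub>R x) - 4 *\<^sub>R f x) (5 * a)"
proof -
  define t where "t = (1/3) *\<^sub>R x"
  define D where "D y = f (2 *\<^sub>R t + y) + f (2 *\<^sub>R t - y) - f (t + y) - f (t - y)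
                - 2 *\<^sub>R f (2 *\<^sub>R t) + 2 *\<^sub>R f t" for y
  define c where "c = N1'' N' \<phi> x a"
  have x: "x = 3 *\<^sub>R t" by (simp add: t_def)
  have c: "c \<le> N (D y) a" if "y \<in> {t, 3 *\<^sub>R t, 4 *\<^sub>R t, - (2 *\<^sub>R t)}" for y
  proof -
    have "c \<le> N' (\<phi> t y) a"
      using le_N1''_iff[of c N' \<phi> x a] that unfolding c_def x by auto
    also have "\<dots> \<le> N (D y) a"
      unfolding D_def by (rule assms(4)[OF a])
    finally show ?thesis .
  qed
  have neg: "f (- (r *\<^sub>R t)) = f (r *\<^sub>R t)" "f (- t) = f t" for r
    by (rule even)+
  \<comment> \<open>Arguments of \<open>f\<close> are collected into single multiples of
    \<open>t\<close>, whose signs \<open>neg\<close> then removes.\<close>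
  have sum: "t + t = 2 *\<^sub>R t" "r *\<^sub>R t + t = (r + 1) *\<^sub>R t" "t + r *\<^sub>R t = (r + 1) *\<^sub>R t"
    "t - r *\<^sub>R t = (1 - r) *\<^sub>R t" "r *\<^sub>R t - t = (r - 1) *\<^sub>R t"
    "r *\<^sub>R t - s *\<^sub>R t = (r - s) *\<^sub>R t" "r *\<^sub>R t + s *\<^sub>R t = (r + s) *\<^sub>R t" for r s
    by (simp_all add: scaleR_2 scaleR_add_left scaleR_diff_left)
  \<comment> \<open>Numeral coefficients in the codomain become repeated sums, so that the final
    cancellation takes place in an abelian group.\<close>
  have multiples: "2 *\<^sub>R v = v + v" "3 *\<^sub>R v = v + v + v" "4 *\<^sub>R v = v + v + v + v" for v :: 'v
    using scaleR_add_left[of 1 1 v] scaleR_add_left[of 2 1 v] scaleR_add_left[of 3 1 v] by simp_all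
  \<comment> \<open>In the first three summands \<open>f (5 t)\<close> and \<open>f (4 t)\<close>
    cancel; subtracting twice \<open>D t\<close> then removes \<open>f (2 t)\<close> and
    \<open>f t\<close> and brings the coefficient of \<open>f (3 t)\<close> to -4.\<close>
  have eq: "f (2 *\<^sub>R x) - 4 *\<^sub>R f x = D (4 *\<^sub>R t) + D (3 *\<^sub>R t) + D (- (2 *\<^sub>R t)) + - (2 *\<^sub>R D t)"
    unfolding D_def x by (simp add: sum neg f0) (simp add: multiples)
  have "c \<le> N (- (2 *\<^sub>R D t)) (2 * a)"
    using c[of t] N_minus N_scaleR[of 2 "D t" a] by simp
  then have "c \<le> N (f (2 *\<^sub>R x) - 4 *\<^sub>R f x) (a + a + a + 2 * a)"
    unfolding eq by (intro le_N_add c) auto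
  then show ?thesis by (simp add: c_def)
qed

section \<open>Iterated doubling and its limit\<close>

text \<open>This isolates what the iteration needs from the control function; the theorem uses it
  with \<open>\<psi>\<close> as \<open>N1'' N' \<phi>\<^sub>1\<close> and
  \<open>K = 5\<close>.\<close>

locale approximately_doubling = fuzzy_normed_space N
  for N :: "'y::real_vector \<Rightarrow> real \<Rightarrow> real" +
  fixes f :: "'x::real_vector \<Rightarrow> 'y" and \<psi> :: "'x \<Rightarrow> real \<Rightarrow> real" and \<alpha> K :: real
  assumes \<alpha>: "0 < \<alpha>" "\<alpha> < 4" and K: "0 < K"
    and \<psi>_le_one: "\<psi> x a \<le> 1"
    and tendsto_\<psi>: "(\<psi> x \<longlongrightarrow> 1) at_top"
    and \<psi>_double: "a > 0 \<Longrightarrow> \<psi> x a \<le> \<psi> (2 *\<^sub>R x) (\<alpha> * a)"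
    and near: "a > 0 \<Longrightarrow> \<psi> x a \<le> N (f (2 *\<^sub>R x) - 4 *\<^sub>R f x) (K * a)"
begin

abbreviation f_approx :: "nat \<Rightarrow> 'x \<Rightarrow> 'y" where
  "f_approx n x \<equiv> (1 / 4 ^ n) *\<^sub>R f (2 ^ n *\<^sub>R x)"

text \<open>The bound is uniform in \<open>n\<close>: its scale is the sum of the geometric series
  with first term \<open>K * a / 4\<close> and ratio \<open>\<alpha> / 4\<close>. The induction
  splits off the first doubling, because \<open>f_approx (Suc n) x\<close> is a quarter of
  \<open>f_approx n\<close> at \<open>2 x\<close>; hence \<open>x\<close> and \<open>a\<close> are
  generalized.\<close>

lemma near_approx:
  assumes "a > 0"
  shows "\<psi> x a \<le> N (f_approx n x - f x) (K * a / (4 - \<alpha>))"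
  using assms
proof (induction n arbitrary: x a)
  case 0
  then show ?case using N_zero \<psi>_le_one \<alpha> K by simp
next
  case (Suc n)
  let ?u = "f_approx n (2 *\<^sub>R x) - f (2 *\<^sub>R x)"
  have "\<psi> x a \<le> \<psi> (2 *\<^sub>R x) (\<alpha> * a)"
    using \<psi>_double[OF Suc.prems] .
  also have "\<dots> \<le> N ?u (K * (\<alpha> * a) / (4 - \<alpha>))"
    using Suc.prems \<alpha> by (intro Suc.IH) auto
  also have "\<dots> = N ((1/4) *\<^sub>R ?u) ((1/4) * (K * (\<alpha> * a) / (4 - \<alpha>)))"
    by (rule N_scaleR[symmetric]) simp
  finally have 1: "\<psi> x a \<le> N ((1/4) *\<^sub>R ?u) ((1/4) * (K * (\<alpha> * a) / (4 - \<alpha>)))" .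
  have 2: "\<psi> x a \<le> N ((1/4) *\<^sub>R (f (2 *\<^sub>R x) - 4 *\<^sub>R f x)) ((1/4) * (K * a))"
    using near[OF Suc.prems, of x] N_scaleR[of "1/4" "f (2 *\<^sub>R x) - 4 *\<^sub>R f x" "K * a"] by simp
  have v: "(1/4) *\<^sub>R ?u + (1/4) *\<^sub>R (f (2 *\<^sub>R x) - 4 *\<^sub>R f x) = f_approx (Suc n) x - f x"
    by (simp add: scaleR_diff_right mult.commute)
  have s: "(1/4) * (K * (\<alpha> * a) / (4 - \<alpha>)) + (1/4) * (K * a) = K * a / (4 - \<alpha>)"
    using \<alpha> by (simp add: field_simps)
  show ?case
    using le_N_add[OF 1 2] by (simp only: v s)
qed

lemma \<psi>_two_power:
  assumes "a > 0" shows "\<psi> x a \<le> \<psi> (2 ^ n *\<^sub>R x) (\<alpha> ^ n * a)"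
proof (induction n)
  case (Suc n)
  have "\<psi> (2 ^ n *\<^sub>R x) (\<alpha> ^ n * a) \<le> \<psi> (2 *\<^sub>R 2 ^ n *\<^sub>R x) (\<alpha> * (\<alpha> ^ n * a))"
    using \<alpha> assms by (intro \<psi>_double) auto
  with Suc show ?case by (simp add: mult.assoc)
qed simp

text \<open>Moving the point by \<open>2 ^ n\<close> costs \<open>\<alpha> ^ n\<close> in scale
  while rescaling gains \<open>4 ^ n\<close>; the surplus is a scale at the fixed point
  \<open>x\<close> that tends to infinity because \<open>\<alpha> < 4\<close>.\<close>

lemma \<psi>_growth:
  assumes "a > 0" shows "\<psi> x ((4 / \<alpha>) ^ n * a) \<le> \<psi> (2 ^ n *\<^sub>R x) (4 ^ n * a)"
  using \<psi>_two_power[of "(4 / \<alpha>) ^ n * a" x n] assms \<alpha> by (simp add: power_divide)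

lemma tendsto_\<psi>_growth:
  assumes "a > 0" shows "(\<lambda>n. \<psi> x ((4 / \<alpha>) ^ n * a)) \<longlonglongrightarrow> 1"
proof -
  have "filterlim (\<lambda>n. (4 / \<alpha>) ^ n * a) at_top sequentially"
    using assms \<alpha> by real_asymp
  then show ?thesis by (rule filterlim_compose[OF tendsto_\<psi>])
qed

text \<open>Up to the factor \<open>4 ^ n\<close>, the difference of two approximants at
  \<open>x\<close> is the error of \<open>f_approx p\<close> at \<open>2 ^ n\<close> times
  \<open>x\<close>, which \<open>near_approx\<close> bounds uniformly in \<open>p\<close>.\<close>

lemma Cauchy_approx: "fuzzy_Cauchy N (\<lambda>n. f_approx n x)"
  unfolding fuzzy_Cauchy_def
proof (intro allI impI)
  fix \<epsilon> a :: real assume "\<epsilon> > 0" "a > 0"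
  \<comment> \<open>Chosen so that \<open>K * b / (4 - \<alpha>) = a\<close>, the scale delivered by
    \<open>near_approx\<close>.\<close>
  define b where "b = a * (4 - \<alpha>) / K"
  have b: "b > 0" using \<open>a > 0\<close> \<alpha> K by (simp add: b_def)
  have "\<forall>\<^sub>F n in sequentially. \<psi> x ((4 / \<alpha>) ^ n * b) > 1 - \<epsilon>"
    using order_tendstoD(1)[OF tendsto_\<psi>_growth[OF b]] \<open>\<epsilon> > 0\<close> by simp
  then obtain n\<^sub>0 where n\<^sub>0: "\<psi> x ((4 / \<alpha>) ^ n * b) > 1 - \<epsilon>" if "n \<ge> n\<^sub>0" for n
    by (auto simp: eventually_sequentially)
  have "N (f_approx (n + p) x - f_approx n x) a > 1 - \<epsilon>" if "n \<ge> n\<^sub>0" for n p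
  proof -
    have "1 - \<epsilon> < \<psi> (2 ^ n *\<^sub>R x) (4 ^ n * b)"
      using n\<^sub>0[OF that] \<psi>_growth[OF b, of x n] by linarith
    also have "\<dots> \<le> N (f_approx p (2 ^ n *\<^sub>R x) - f (2 ^ n *\<^sub>R x)) (K * (4 ^ n * b) / (4 - \<alpha>))"
      using b by (intro near_approx) simp
    also have "K * (4 ^ n * b) / (4 - \<alpha>) = 4 ^ n * a"
      using \<alpha> K by (simp add: b_def)
    also have "N (f_approx p (2 ^ n *\<^sub>R x) - f (2 ^ n *\<^sub>R x)) (4 ^ n * a) =
        N ((1 / 4 ^ n) *\<^sub>R (f_approx p (2 ^ n *\<^sub>R x) - f (2 ^ n *\<^sub>R x))) ((1 / 4 ^ n) * (4 ^ n * a))"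
      by (rule N_scaleR[symmetric]) simp
    also have "(1 / 4 ^ n) *\<^sub>R (f_approx p (2 ^ n *\<^sub>R x) - f (2 ^ n *\<^sub>R x)) = f_approx (n + p) x - f_approx n x"
      by (simp add: scaleR_diff_right power_add mult.commute)
    finally show ?thesis by simp
  qed
  then show "\<exists>n\<^sub>0. \<forall>n\<ge>n\<^sub>0. \<forall>p>0. N (f_approx (n + p) x - f_approx n x) a > 1 - \<epsilon>"
    by blast
qed

text \<open>The strict inequality \<open>L > K\<close> leaves a positive share of the scale
  \<open>a\<close> for the distance from \<open>f_approx n x\<close> to \<open>q\<close>; the rest
  is what \<open>near_approx\<close> consumes.\<close>

lemma limit_near:
  assumes lim: "fuzzy_tendsto N (\<lambda>n. f_approx n x) q" and "L > K" and "a > 0"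
  shows "\<psi> x (a * (4 - \<alpha>) / L) \<le> N (q - f x) a"
proof -
  define b where "b = a * (4 - \<alpha>) / L"
  have b: "b > 0" and rest: "(L - K) * b / (4 - \<alpha>) > 0"
    using assms \<alpha> K by (auto simp: b_def)
  have split: "a = (L - K) * b / (4 - \<alpha>) + K * b / (4 - \<alpha>)"
  proof -
    have "(L - K) * b / (4 - \<alpha>) + K * b / (4 - \<alpha>) = L * b / (4 - \<alpha>)"
      by (simp add: left_diff_distrib flip: add_divide_distrib)
    then show ?thesis
      using assms(2) \<alpha> K by (simp add: b_def)
  qed
  \<comment> \<open>The first term of the minimum tends to 1, so only \<open>\<psi> x b\<close>
    survives in the limit.\<close>
  have "min (N (f_approx n x - q) ((L - K) * b / (4 - \<alpha>))) (\<psi> x b) \<le> N (q - f x) a" for n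
  proof -
    have "min (N (f_approx n x - q) ((L - K) * b / (4 - \<alpha>))) (\<psi> x b) \<le> N ((q - f_approx n x) + (f_approx n x - f x)) a"
      unfolding split using near_approx[OF b, of x n]
      by (intro le_N_add) (auto simp: N_diff_commute[of q])
    then show ?thesis by simp
  qed
  moreover have "(\<lambda>n. min (N (f_approx n x - q) ((L - K) * b / (4 - \<alpha>))) (\<psi> x b)) \<longlonglongrightarrow> min 1 (\<psi> x b)"
    using lim rest unfolding fuzzy_tendsto_def by (intro tendsto_min tendsto_const) auto
  ultimately have "min 1 (\<psi> x b) \<le> N (q - f x) a"
    by (intro LIMSEQ_le_const2) auto
  then show ?thesis
    using \<psi>_le_one[of x b] by (simp add: b_def)
qed

text \<open>This yields uniqueness: a quadratic map commutes with the rescaling, so its distance to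
  \<open>f_approx n x\<close> is a rescaled distance to \<open>f\<close>, governed by the growing
  scale of \<open>\<psi>_growth\<close>.\<close>

lemma tendsto_near_quadratic:
  assumes Q: "quadratic Q" and "L > 0"
    and bound: "\<And>x a. a > 0 \<Longrightarrow> \<psi> x (a * (4 - \<alpha>) / L) \<le> N (Q x - f x) a"
  shows "fuzzy_tendsto N (\<lambda>n. f_approx n x) (Q x)"
  unfolding fuzzy_tendsto_def
proof (intro allI impI)
  fix a :: real assume "a > 0"
  define b where "b = a * (4 - \<alpha>) / L"
  have b: "b > 0" using \<open>a > 0\<close> \<open>L > 0\<close> \<alpha> by (simp add: b_def)
  have "\<psi> x ((4 / \<alpha>) ^ n * b) \<le> N (f_approx n x - Q x) a" for n
  proof -
    have "\<psi> x ((4 / \<alpha>) ^ n * b) \<le> \<psi> (2 ^ n *\<^sub>R x) (4 ^ n * b)"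
      by (rule \<psi>_growth[OF b])
    also have "\<dots> \<le> N (Q (2 ^ n *\<^sub>R x) - f (2 ^ n *\<^sub>R x)) (4 ^ n * a)"
      using bound[of "4 ^ n * a"] \<open>a > 0\<close> by (simp add: b_def mult.assoc)
    also have "\<dots> = N ((1 / 4 ^ n) *\<^sub>R (f (2 ^ n *\<^sub>R x) - Q (2 ^ n *\<^sub>R x))) ((1 / 4 ^ n) * (4 ^ n * a))"
      by (subst N_diff_commute, rule N_scaleR[symmetric]) simp
    also have "(1 / 4 ^ n) *\<^sub>R (f (2 ^ n *\<^sub>R x) - Q (2 ^ n *\<^sub>R x)) = f_approx n x - Q x"
      by (simp add: scaleR_diff_right quadratic_scaleR_two_power[OF Q])
    finally show ?thesis by simp
  qed
  then show "(\<lambda>n. N (f_approx n x - Q x) a) \<longlonglongrightarrow> 1"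
    by (rule tendsto_oneI[OF _ tendsto_\<psi>_growth[OF b]])
qed

text \<open>The sequence at \<open>2 x\<close> is 4 times the shifted sequence at
  \<open>x\<close>.\<close>

lemma limit_double:
  assumes "\<And>x. fuzzy_tendsto N (\<lambda>n. f_approx n x) (Q x)"
  shows "Q (2 *\<^sub>R x) = 4 *\<^sub>R Q x"
proof (rule fuzzy_tendsto_unique)
  from fuzzy_tendsto_scaleR[OF fuzzy_tendsto_Suc[OF assms[of x]], of 4]
  show "fuzzy_tendsto N (\<lambda>n. f_approx n (2 *\<^sub>R x)) (4 *\<^sub>R Q x)"
    by (simp add: mult.commute)
qed (rule assms)

end

section \<open>Existence and uniqueness of the quadratic map\<close>

theorem theorem2p1:
  fixes N :: "'y::real_vector \<Rightarrow> real \<Rightarrow> real"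
    and N' :: "'z::real_vector \<Rightarrow> real \<Rightarrow> real"
    and \<phi>\<^sub>1 :: "'x::real_vector \<Rightarrow> 'x \<Rightarrow> 'z"
    and f :: "'x \<Rightarrow> 'y"
    and \<alpha> :: real
  assumes "fuzzy_Banach_space N"
    and "fuzzy_normed_space N'"
    and "0 < \<alpha>" and "\<alpha> < 4"
    and "\<And>x y a. y \<in> {0, (1/3) *\<^sub>R x, (4/3) *\<^sub>R x, (-2/3) *\<^sub>R x, x} \<Longrightarrow> a > 0 \<Longrightarrow>
           N' (\<phi>\<^sub>1 ((2/3) *\<^sub>R x) (2 *\<^sub>R y)) a \<ge> N' (\<alpha> *\<^sub>R \<phi>\<^sub>1 ((1/3) *\<^sub>R x) y) a"
    and "\<And>x y a. a > 0 \<Longrightarrow>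
           (\<lambda>n. N' (\<phi>\<^sub>1 (2 ^ n *\<^sub>R x) (2 ^ n *\<^sub>R y)) (4 ^ n * a)) \<longlonglongrightarrow> 1"
    and "\<And>x. f (- x) = f x"
    and "f 0 = 0"
    and "\<And>x y a. a > 0 \<Longrightarrow>
           N (f (2 *\<^sub>R x + y) + f (2 *\<^sub>R x - y) - f (x + y) - f (x - y)
                - 2 *\<^sub>R f (2 *\<^sub>R x) + 2 *\<^sub>R f x) a
             \<ge> N' (\<phi>\<^sub>1 x y) a"
  shows "\<exists>!Q :: 'x \<Rightarrow> 'y. quadratic Q \<and>
           (\<forall>x. \<forall>a>0. N (Q x - f x) a \<ge> N1'' N' \<phi>\<^sub>1 x (a * (4 - \<alpha>) / 6))"
proof -
  interpret Y: fuzzy_Banach_space N by fact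
  interpret Z: fuzzy_normed_space N' by fact
  interpret approximately_doubling N f "N1'' N' \<phi>\<^sub>1" \<alpha> 5
  proof
    fix x :: 'x and a :: real
    have "N1'' N' \<phi>\<^sub>1 x a \<le> N' (\<phi>\<^sub>1 ((1/3) *\<^sub>R x) 0) a"
      using le_N1''_iff[of "N1'' N' \<phi>\<^sub>1 x a" N' \<phi>\<^sub>1 x a] by simp
    then show "N1'' N' \<phi>\<^sub>1 x a \<le> 1"
      using Z.le_one order.trans by blast
    show "(N1'' N' \<phi>\<^sub>1 x \<longlongrightarrow> 1) at_top"
      using tendsto_N1''[OF assms(2) filterlim_ident] .
    assume "a > 0"
    then show "N1'' N' \<phi>\<^sub>1 x a \<le> N1'' N' \<phi>\<^sub>1 (2 *\<^sub>R x) (\<alpha> * a)"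
      using N1''_double[OF assms(2,3), of a x \<phi>\<^sub>1] assms(5) by blast
    show "N1'' N' \<phi>\<^sub>1 x a \<le> N (f (2 *\<^sub>R x) - 4 *\<^sub>R f x) (5 * a)"
      by (rule Y.near_doubling[OF assms(7,8) \<open>a > 0\<close> assms(9)])
  qed (use assms(3,4) in auto)
  \<comment> \<open>Completeness provides a limit at every point for this choice.\<close>
  define Q where "Q x = (SOME q. fuzzy_tendsto N (\<lambda>n. f_approx n x) q)" for x
  have lim: "fuzzy_tendsto N (\<lambda>n. f_approx n x) (Q x)" for x
    using Y.complete[OF Cauchy_approx] someI_ex[of "fuzzy_tendsto N (\<lambda>n. f_approx n x)"]
    unfolding Q_def fuzzy_convergent_def fuzzy_tendsto_def by blast
  have "quadratic Q"
  proof (rule quadraticI_doubling)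
    show "Q (- x) = Q x" for x
      using Y.fuzzy_tendsto_unique[OF lim[of "-x"]] lim[of x] by (simp add: assms(7))
    show "Q (2 *\<^sub>R x) = 4 *\<^sub>R Q x" for x
      by (rule limit_double[OF lim])
    fix x y
    let ?D = "\<lambda>f x y. f (2 *\<^sub>R x + y) + f (2 *\<^sub>R x - y) - f (x + y) - f (x - y)
                - 2 *\<^sub>R f (2 *\<^sub>R x) + 2 *\<^sub>R f x :: 'y"
    show "?D Q x y = 0"
    \<comment> \<open>One sequence gets two limits: \<open>?D Q x y\<close> by linearity of
      \<open>?D\<close> in the function, and 0 by the decay hypothesis on
      \<open>\<phi>\<^sub>1\<close> at the points scaled by \<open>2 ^ n\<close>.\<close>
    proof (rule Y.fuzzy_tendsto_unique)
      show "fuzzy_tendsto N (\<lambda>n. ?D (f_approx n) x y) (?D Q x y)"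
        by (intro Y.fuzzy_tendsto_add Y.fuzzy_tendsto_diff Y.fuzzy_tendsto_scaleR lim)
      show "fuzzy_tendsto N (\<lambda>n. ?D (f_approx n) x y) 0"
        unfolding fuzzy_tendsto_def
      proof (intro allI impI)
        fix a :: real assume "a > 0"
        have "N' (\<phi>\<^sub>1 (2 ^ n *\<^sub>R x) (2 ^ n *\<^sub>R y)) (4 ^ n * a) \<le> N (?D (f_approx n) x y - 0) a" for n
        proof -
          have "N' (\<phi>\<^sub>1 (2 ^ n *\<^sub>R x) (2 ^ n *\<^sub>R y)) (4 ^ n * a)
              \<le> N (?D f (2 ^ n *\<^sub>R x) (2 ^ n *\<^sub>R y)) (4 ^ n * a)"
            using \<open>a > 0\<close> by (intro assms(9)) simp
          also have "\<dots> = N ((1 / 4 ^ n) *\<^sub>R ?D f (2 ^ n *\<^sub>R x) (2 ^ n *\<^sub>R y)) ((1 / 4 ^ n) * (4 ^ n * a))"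
            by (rule Y.N_scaleR[symmetric]) simp
          also have "(1 / 4 ^ n) *\<^sub>R ?D f (2 ^ n *\<^sub>R x) (2 ^ n *\<^sub>R y) = ?D (f_approx n) x y"
            by (simp add: scaleR_add_right scaleR_diff_right mult.commute)
          finally show ?thesis by simp
        qed
        then show "(\<lambda>n. N (?D (f_approx n) x y - 0) a) \<longlonglongrightarrow> 1"
          by (rule Y.tendsto_oneI[OF _ assms(6)[OF \<open>a > 0\<close>]])
      qed
    qed
  qed
  \<comment> \<open>Here \<open>L = 6\<close> exceeds \<open>K = 5\<close>.\<close>
  moreover have "N1'' N' \<phi>\<^sub>1 x (a * (4 - \<alpha>) / 6) \<le> N (Q x - f x) a" if "a > 0" for x a
    by (rule limit_near[OF lim _ that]) simp
  \<comment> \<open>Any competitor is a limit of the same sequence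
    \<open>f_approx n x\<close>.\<close>
  moreover have "Q' = Q"
    if "quadratic Q'" and "\<And>x a. a > 0 \<Longrightarrow> N1'' N' \<phi>\<^sub>1 x (a * (4 - \<alpha>) / 6) \<le> N (Q' x - f x) a" for Q'
    using Y.fuzzy_tendsto_unique[OF tendsto_near_quadratic[OF that(1) _ that(2)] lim] by auto
  ultimately show ?thesis
    by blast
qed

end
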